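(* Let $P\in\mathbb{P}_m(\mathbb{C}^{n\times n})$ be a regular symmetric matrix polynomial and let $L\in\mathbb{L}_1(P)$ be a symmetric linearization of $P$ with normalized right ansatz vector $v$ ($\|v\|_2=1$). Let $(\lambda,x)\in\mathbb{C}\times\mathbb{C}^n$ be such that $\|x\|_2=1$ and $P(\lambda)x\neq0$. Let $\Lambda_{m-1}:=[\lambda^{m-1},\ldots,\lambda,1]^T$. With $\mathbb{S}$ denoting the symmetric structure (symmetric polynomials in $\mathbb{P}_m(\mathbb{C}^{n\times n})$ for $P$, symmetric pencils in $\mathbb{P}_1(\mathbb{C}^{mn\times mn})$ for $L$), we have $$\sqrt{\frac{m+1}{2m}}\le\frac{\eta_F^{\mathbb{S}}(\lambda,\Lambda_{m-1}\otimes x,L;v)}{\eta_F^{\mathbb{S}}(\lambda,x,P)}\le\frac{\eta_F^{\mathbb{S}}(\lambda,\Lambda_{m-1}\otimes x,L;v)}{\eta(\lambda,x,P)}\le\sqrt2,$$ $$\sqrt{\frac{m+1}{2m}}\le\frac{\eta_2^{\mathbb{S}}(\lambda,\Lambda_{m-1}\otimes x,L;v)}{\eta_2^{\mathbb{S}}(\lambda,x,P)}=\frac{\eta(\lambda,\Lambda_{m-1}\otimes x,L;v)}{\eta(\lambda,x,P)}\le1.$$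
   Context: $m,n\ge1$ are integers. $\mathbb{P}_k(\mathbb{C}^{N\times N})$ is the vector space of matrix polynomials $Q(z)=\sum_{j=0}^k z^jA_j$, $A_j\in\mathbb{C}^{N\times N}$. $Q$ is regular if $\det Q(z)\not\equiv0$, and symmetric if all $A_j^T=A_j$. For $M\in\{2,F\}$, $|||Q|||_M:=\left(\sum_{j=0}^k\|A_j\|_M^2\right)^{1/2}$ with $\|\cdot\|_F$ Frobenius and $\|\cdot\|_2$ spectral norm. For $Q\in\mathbb{P}_k(\mathbb{C}^{N\times N})$ regular, $\lambda\in\mathbb{C}$, $u\in\mathbb{C}^N\setminus\{0\}$: $\eta(\lambda,u,Q):=\inf\{|||\Delta Q|||_M:\Delta Q\in\mathbb{P}_k(\mathbb{C}^{N\times N}),\ Q(\lambda)u+\Delta Q(\lambda)u=0\}=\|Q(\lambda)u\|_2/(\|u\|_2\|[1,\lambda,\ldots,\lambda^k]^T\|_2)$ (the same for $M=2,F$), and for a structure class $\mathbb{S}\subset\mathbb{P}_k(\mathbb{C}^{N\times N})$ with $Q\in\mathbb{S}$, $\eta_M^{\mathbb{S}}(\lambda,u,Q):=\inf\{|||\Delta Q|||_M:\Delta Q\in\mathbb{S},\ Q(\lambda)u+\Delta Q(\lambda)u=0\}$. $\mathbb{L}_1(P)$ is the set of pencils $L(z)=zX+Y$, $X,Y\in\mathbb{C}^{mn\times mn}$, for which there is $v\in\mathbb{C}^m$ (the right ansatz vector of $L$) with $L(z)\,([z^{m-1},z^{m-2},\ldots,1]^T\otimes I_n)=v\otimes P(z)$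 for all $z$; $\otimes$ is the Kronecker product. $L$ is a linearization of $P$ if there are unimodular matrix polynomials $E,F$ with $E(z)L(z)F(z)=\mathrm{diag}(P(z),I_{(m-1)n})$. The pencil $L$ is viewed as an element of $\mathbb{P}_1(\mathbb{C}^{mn\times mn})$, and $\eta(\lambda,\cdot,L;v)$, $\eta_M^{\mathbb{S}}(\lambda,\cdot,L;v)$ are its (structured) backward errors, the $v$ only recording the ansatz vector. *)

theory Defs
  imports "Jordan_Normal_Form.Determinant" "HOL-Analysis.L2_Norm"
begin

definition norm2_vec :: "complex vec \<Rightarrow> real" where
  "norm2_vec v = L2_set (\<lambda>i. cmod (v $ i)) {..<dim_vec v}"

datatype matrix_norm = Spectral | Frobenius

text \<open>The ball rather than the sphere is used in the spectral norm, so that the supremum is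
  taken over a nonempty set in every dimension.\<close>

fun norm_mat :: "matrix_norm \<Rightarrow> complex mat \<Rightarrow> real" where
  "norm_mat Spectral A =
     (SUP v \<in> {v \<in> carrier_vec (dim_col A). norm2_vec v \<le> 1}. norm2_vec (A *\<^sub>v v))"
| "norm_mat Frobenius A =
     L2_set (\<lambda>(i, j). cmod (A $$ (i, j))) ({..<dim_row A} \<times> {..<dim_col A})"

text \<open>A matrix polynomial $\sum_j z^j A_j$ is represented as a matrix whose entries are
  polynomials; $A_j$ is obtained by taking the $j$-th coefficient of every entry.\<close>

definition mp_coeff :: "complex poly mat \<Rightarrow> nat \<Rightarrow> complex mat" where
  "mp_coeff Q j = map_mat (\<lambda>p. coeff p j) Q"

definition mp_eval :: "complex poly mat \<Rightarrow> complex \<Rightarrow> complex mat" where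
  "mp_eval Q z = map_mat (\<lambda>p. poly p z) Q"

text \<open>$\mathbb{P}_k(\mathbb{C}^{N\times N})$: degree at most $k$, leading coefficient possibly zero.\<close>

definition mat_polys :: "nat \<Rightarrow> nat \<Rightarrow> complex poly mat set" where
  "mat_polys k N = {Q \<in> carrier_mat N N. \<forall>i<N. \<forall>j<N. degree (Q $$ (i, j)) \<le> k}"

definition sym_mat_polys :: "nat \<Rightarrow> nat \<Rightarrow> complex poly mat set" where
  "sym_mat_polys k N =
     {Q \<in> mat_polys k N. \<forall>j\<le>k. transpose_mat (mp_coeff Q j) = mp_coeff Q j}"

definition regular_mp :: "complex poly mat \<Rightarrow> bool" where
  "regular_mp Q \<longleftrightarrow> det Q \<noteq> 0"

definition unimodular_mp :: "complex poly mat \<Rightarrow> bool" where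
  "unimodular_mp Q \<longleftrightarrow> square_mat Q \<and> (\<exists>c. c \<noteq> 0 \<and> det Q = [:c:])"

definition norm_mp :: "matrix_norm \<Rightarrow> nat \<Rightarrow> complex poly mat \<Rightarrow> real" where
  "norm_mp M k Q = sqrt (\<Sum>j\<le>k. (norm_mat M (mp_coeff Q j))\<^sup>2)"

text \<open>The argument \<open>k\<close> is the grade, i.e. $Q$ is regarded as an element of
  $\mathbb{P}_k(\mathbb{C}^{N\times N})$.\<close>

definition structured_backward_error ::
  "matrix_norm \<Rightarrow> complex poly mat set \<Rightarrow> nat \<Rightarrow> complex \<Rightarrow> complex vec \<Rightarrow> complex poly mat \<Rightarrow> real"
where
  "structured_backward_error M S k lam u Q =
     Inf {norm_mp M k \<Delta>Q | \<Delta>Q.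
            \<Delta>Q \<in> S \<and> mp_eval Q lam *\<^sub>v u + mp_eval \<Delta>Q lam *\<^sub>v u = 0\<^sub>v (dim_row Q)}"

definition backward_error ::
  "matrix_norm \<Rightarrow> nat \<Rightarrow> complex \<Rightarrow> complex vec \<Rightarrow> complex poly mat \<Rightarrow> real"
where
  "backward_error M k lam u Q =
     structured_backward_error M (mat_polys k (dim_row Q)) k lam u Q"

definition kron_mat :: "'a :: semiring_1 mat \<Rightarrow> 'a mat \<Rightarrow> 'a mat" where
  "kron_mat A B = mat (dim_row A * dim_row B) (dim_col A * dim_col B)
     (\<lambda>(i, j). A $$ (i div dim_row B, j div dim_col B) * B $$ (i mod dim_row B, j mod dim_col B))"

definition kron_vec :: "'a :: semiring_1 vec \<Rightarrow> 'a vec \<Rightarrow> 'a vec" where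
  "kron_vec u w = vec (dim_vec u * dim_vec w)
     (\<lambda>i. u $ (i div dim_vec w) * w $ (i mod dim_vec w))"

definition col_mat :: "'a vec \<Rightarrow> 'a mat" where
  "col_mat v = mat_of_cols (dim_vec v) [v]"

text \<open>The index is shifted: \<open>Lambda_vec m lam\<close> is $\Lambda_{m-1} = [\lambda^{m-1},\ldots,\lambda,1]^T \in \mathbb{C}^m$.\<close>

definition Lambda_vec :: "nat \<Rightarrow> complex \<Rightarrow> complex vec" where
  "Lambda_vec m lam = vec m (\<lambda>i. lam ^ (m - 1 - i))"

definition right_ansatz_vec ::
  "nat \<Rightarrow> nat \<Rightarrow> complex poly mat \<Rightarrow> complex poly mat \<Rightarrow> complex vec \<Rightarrow> bool"
where
  "right_ansatz_vec m n P L v \<longleftrightarrow> v \<in> carrier_vec m \<and>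
     (\<forall>z. mp_eval L z * kron_mat (col_mat (Lambda_vec m z)) (1\<^sub>m n)
          = kron_mat (col_mat v) (mp_eval P z))"

definition L1_space :: "nat \<Rightarrow> nat \<Rightarrow> complex poly mat \<Rightarrow> complex poly mat set" where
  "L1_space m n P = {L \<in> mat_polys 1 (m * n). \<exists>v. right_ansatz_vec m n P L v}"

definition linearization_of ::
  "nat \<Rightarrow> nat \<Rightarrow> complex poly mat \<Rightarrow> complex poly mat \<Rightarrow> bool"
where
  "linearization_of m n P L \<longleftrightarrow> L \<in> mat_polys 1 (m * n) \<and>
     (\<exists>E F. E \<in> carrier_mat (m * n) (m * n) \<and> F \<in> carrier_mat (m * n) (m * n) \<and>
        unimodular_mp E \<and> unimodular_mp F \<and>
        E * L * F = diag_block_mat [P, 1\<^sub>m ((m - 1) * n)])"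

end

theory Submission
  imports Defs
begin

text \<open>By Cauchy--Schwarz, a (structured) backward error is the least norm of a (structured)
  matrix \<open>A\<close> with \<open>A u = - Q(\<lambda>) u\<close>, divided by the norm of \<open>[1, \<lambda>, \<dots>, \<lambda>^k]\<close>. With
  \<open>w = - Q(\<lambda>) u\<close>, this least norm is \<open>|w| / |u|\<close> without structure, and also for symmetric
  matrices in the spectral norm; for symmetric matrices in the Frobenius norm it is
  \<open>sqrt (2 |w|^2 - |u^T w|^2 / |u|^2) / |u|\<close>. For \<open>L\<close> and \<open>u = \<Lambda> \<otimes> x\<close> the residual is
  \<open>v \<otimes> P(\<lambda>) x\<close>, of the same norm as \<open>P(\<lambda>) x\<close>, while \<open>|u^T w| / |u|\<close> only decreases since
  \<open>|\<Lambda>^T v| \<le> |\<Lambda>|\<close>. What remains is to compare the norms of \<open>[1, \<lambda>, \<dots>, \<lambda>^m]\<close> and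
  \<open>[1, \<lambda>] \<otimes> \<Lambda>\<close>, which reduces to \<open>t^i + t^j \<le> 1 + t^(i + j)\<close> for \<open>t = |\<lambda>|^2\<close>.\<close>

section \<open>Cauchy--Schwarz, Pythagoras and Bessel for finite complex sums\<close>

lemma norm_sum_mult_le:
  fixes f g :: "'a \<Rightarrow> complex"
  shows "norm (\<Sum>i\<in>I. f i * g i) \<le> L2_set (\<lambda>i. norm (f i)) I * L2_set (\<lambda>i. norm (g i)) I"
proof -
  have "norm (\<Sum>i\<in>I. f i * g i) \<le> (\<Sum>i\<in>I. \<bar>norm (f i)\<bar> * \<bar>norm (g i)\<bar>)"
    by (rule order_trans[OF norm_sum]) (simp add: norm_mult)
  also have "\<dots> \<le> L2_set (\<lambda>i. norm (f i)) I * L2_set (\<lambda>i. norm (g i)) I"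
    by (rule L2_set_mult_ineq)
  finally show ?thesis .
qed

lemma L2_set_norm_add_le:
  "L2_set (\<lambda>i. norm (f i + g i)) I \<le> L2_set (\<lambda>i. norm (f i)) I + L2_set (\<lambda>i. norm (g i)) I"
  by (rule order_trans[OF L2_set_mono L2_set_triangle_ineq]) (auto intro: norm_triangle_ineq)

text \<open>Embedding squared norms into the complex numbers turns norm identities into algebraic
  identities between sums with \<open>cnj\<close>, which can simply be expanded.\<close>

lemma of_real_L2_set_sq:
  "complex_of_real ((L2_set (\<lambda>i. cmod (f i)) I)\<^sup>2) = (\<Sum>i\<in>I. f i * cnj (f i))"
  unfolding complex_norm_square[symmetric] of_real_power[symmetric] of_real_sum[symmetric]
  by (simp add: L2_set_def sum_nonneg)

lemma L2_set_pythagoras: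
  fixes f g :: "'a \<Rightarrow> complex"
  assumes "(\<Sum>i\<in>I. f i * cnj (g i)) = 0"
  shows "(L2_set (\<lambda>i. cmod (a * f i + b * g i)) I)\<^sup>2
    = (cmod a)\<^sup>2 * (L2_set (\<lambda>i. cmod (f i)) I)\<^sup>2 + (cmod b)\<^sup>2 * (L2_set (\<lambda>i. cmod (g i)) I)\<^sup>2"
proof -
  have "cnj (\<Sum>i\<in>I. f i * cnj (g i)) = 0"
    using assms by simp
  then have 2: "(\<Sum>i\<in>I. g i * cnj (f i)) = 0"
    by (simp add: mult.commute)
  have "(\<Sum>i\<in>I. (a * f i + b * g i) * cnj (a * f i + b * g i))
      = a * cnj a * (\<Sum>i\<in>I. f i * cnj (f i)) + a * cnj b * (\<Sum>i\<in>I. f i * cnj (g i))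
        + b * cnj a * (\<Sum>i\<in>I. g i * cnj (f i)) + b * cnj b * (\<Sum>i\<in>I. g i * cnj (g i))"
    unfolding sum_distrib_left sum.distrib[symmetric]
    by (intro sum.cong refl) (simp add: algebra_simps)
  then have "complex_of_real ((L2_set (\<lambda>i. cmod (a * f i + b * g i)) I)\<^sup>2)
      = complex_of_real ((cmod a)\<^sup>2 * (L2_set (\<lambda>i. cmod (f i)) I)\<^sup>2
          + (cmod b)\<^sup>2 * (L2_set (\<lambda>i. cmod (g i)) I)\<^sup>2)"
    unfolding of_real_add of_real_mult of_real_L2_set_sq complex_norm_square
    using assms 2 by simp
  then show ?thesis
    by (simp only: of_real_eq_iff)
qed

text \<open>Removing from \<open>y\<close> its projections onto \<open>u\<close> and
  \<open>w\<close> leaves a remainder \<open>D\<close> orthogonal to both, and Pythagoras applies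
  twice. Either vector may vanish on \<open>I\<close>: division by zero then makes its term
  0.\<close>

lemma L2_set_bessel:
  fixes u w y :: "'a \<Rightarrow> complex"
  assumes fin: "finite I" and orth: "(\<Sum>i\<in>I. u i * cnj (w i)) = 0"
  shows "(cmod (\<Sum>i\<in>I. y i * cnj (u i)))\<^sup>2 / (L2_set (\<lambda>i. cmod (u i)) I)\<^sup>2
    + (cmod (\<Sum>i\<in>I. y i * cnj (w i)))\<^sup>2 / (L2_set (\<lambda>i. cmod (w i)) I)\<^sup>2
    \<le> (L2_set (\<lambda>i. cmod (y i)) I)\<^sup>2"
proof -
  define \<alpha> where "\<alpha> = (L2_set (\<lambda>i. cmod (u i)) I)\<^sup>2"
  define \<tau> where "\<tau> = (L2_set (\<lambda>i. cmod (w i)) I)\<^sup>2"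
  define a where "a = (\<Sum>i\<in>I. y i * cnj (u i))"
  define b where "b = (\<Sum>i\<in>I. y i * cnj (w i))"
  define p where "p = a / of_real \<alpha>"
  define q where "q = b / of_real \<tau>"
  have orth': "(\<Sum>i\<in>I. w i * cnj (u i)) = 0"
    using arg_cong[OF orth, of cnj] by (simp add: mult.commute)
  \<comment> \<open>In this degenerate case \<open>u\<close> vanishes on \<open>I\<close>, so
    \<open>Du\<close> stays true although \<open>p\<close> is a quotient by zero.\<close>
  have z: "a = 0" if "\<alpha> = 0"
    using that fin by (simp add: \<alpha>_def a_def L2_set_eq_0_iff)
  have z': "b = 0" if "\<tau> = 0"
    using that fin by (simp add: \<tau>_def b_def L2_set_eq_0_iff)
  define D where "D i = y i - p * u i - q * w i" for i
  have Du: "(\<Sum>i\<in>I. D i * cnj (u i)) = 0"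
  proof -
    have "(\<Sum>i\<in>I. D i * cnj (u i)) = a - p * (\<Sum>i\<in>I. u i * cnj (u i)) - q * (\<Sum>i\<in>I. w i * cnj (u i))"
      unfolding D_def a_def sum_distrib_left sum_subtractf[symmetric]
      by (intro sum.cong refl) (simp add: algebra_simps)
    also have "\<dots> = 0"
      using z by (simp add: orth' of_real_L2_set_sq[symmetric] \<alpha>_def[symmetric] p_def del: of_real_power)
    finally show ?thesis .
  qed
  have Dw: "(\<Sum>i\<in>I. D i * cnj (w i)) = 0"
  proof -
    have "(\<Sum>i\<in>I. D i * cnj (w i)) = b - p * (\<Sum>i\<in>I. u i * cnj (w i)) - q * (\<Sum>i\<in>I. w i * cnj (w i))"
      unfolding D_def b_def sum_distrib_left sum_subtractf[symmetric]
      by (intro sum.cong refl) (simp add: algebra_simps)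
    also have "\<dots> = 0"
      using z' by (simp add: orth of_real_L2_set_sq[symmetric] \<tau>_def[symmetric] q_def del: of_real_power)
    finally show ?thesis .
  qed
  have "(\<Sum>i\<in>I. D i * cnj (p * u i + q * w i))
      = cnj p * (\<Sum>i\<in>I. D i * cnj (u i)) + cnj q * (\<Sum>i\<in>I. D i * cnj (w i))"
    unfolding sum_distrib_left sum.distrib[symmetric]
    by (intro sum.cong refl) (simp add: algebra_simps)
  then have "(\<Sum>i\<in>I. D i * cnj (p * u i + q * w i)) = 0"
    using Du Dw by simp
  from L2_set_pythagoras[OF this, of 1 1]
  have "(L2_set (\<lambda>i. cmod (y i)) I)\<^sup>2
      = (L2_set (\<lambda>i. cmod (D i)) I)\<^sup>2 + (L2_set (\<lambda>i. cmod (p * u i + q * w i)) I)\<^sup>2"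
    by (simp add: D_def)
  also have "(L2_set (\<lambda>i. cmod (p * u i + q * w i)) I)\<^sup>2 = (cmod p)\<^sup>2 * \<alpha> + (cmod q)\<^sup>2 * \<tau>"
    unfolding \<alpha>_def \<tau>_def by (rule L2_set_pythagoras[OF orth])
  also have "(cmod p)\<^sup>2 * \<alpha> = (cmod a)\<^sup>2 / \<alpha>"
    by (simp add: p_def norm_divide power_divide power2_eq_square)
  also have "(cmod q)\<^sup>2 * \<tau> = (cmod b)\<^sup>2 / \<tau>"
    by (simp add: q_def norm_divide power_divide power2_eq_square)
  finally have "(L2_set (\<lambda>i. cmod (y i)) I)\<^sup>2
      = (L2_set (\<lambda>i. cmod (D i)) I)\<^sup>2 + ((cmod a)\<^sup>2 / \<alpha> + (cmod b)\<^sup>2 / \<tau>)" .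
  then show ?thesis
    unfolding \<alpha>_def[symmetric] \<tau>_def[symmetric] a_def[symmetric] b_def[symmetric]
    using zero_le_power2[of "L2_set (\<lambda>i. cmod (D i)) I"] by linarith
qed

subsection \<open>Vector and matrix norms\<close>

lemma mult_mat_vec_nth:
  assumes "A \<in> carrier_mat N K" "y \<in> carrier_vec K" "i < N"
  shows "(A *\<^sub>v y) $ i = (\<Sum>j<K. A $$ (i, j) * y $ j)"
  using assms by (auto simp: scalar_prod_def lessThan_atLeast0 intro!: sum.cong)

lemma norm2_vec_nonneg [simp]: "0 \<le> norm2_vec v"
  by (simp add: norm2_vec_def)

lemma norm2_vec_zero [simp]: "norm2_vec (0\<^sub>v N) = 0"
  by (simp add: norm2_vec_def L2_set_def)

lemma norm2_vec_eq_0_iff: "v \<in> carrier_vec N \<Longrightarrow> norm2_vec v = 0 \<longleftrightarrow> v = 0\<^sub>v N"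
  by (auto simp: norm2_vec_def L2_set_eq_0_iff)

lemma norm2_vec_smult: "norm2_vec (c \<cdot>\<^sub>v v) = cmod c * norm2_vec v"
  by (simp add: norm2_vec_def L2_set_right_distrib) (intro L2_set_cong, auto simp: norm_mult)

lemma norm2_vec_uminus [simp]: "norm2_vec (- v) = norm2_vec v"
  by (simp add: norm2_vec_def L2_set_def)

lemma norm2_vec_add_le:
  assumes "v \<in> carrier_vec N" "w \<in> carrier_vec N"
  shows "norm2_vec (v + w) \<le> norm2_vec v + norm2_vec w"
proof -
  have "norm2_vec (v + w) = L2_set (\<lambda>i. cmod (v $ i + w $ i)) {..<N}"
    unfolding norm2_vec_def using assms by (intro L2_set_cong) auto
  then show ?thesis
    using L2_set_norm_add_le[of "\<lambda>i. v $ i" "\<lambda>i. w $ i" "{..<N}"] assms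
    by (simp add: norm2_vec_def)
qed

text \<open>Cauchy--Schwarz row by row. The bound also shows that the supremum defining the spectral
  norm ranges over a bounded set.\<close>

lemma norm2_mult_le_Frobenius:
  assumes "A \<in> carrier_mat N K" "y \<in> carrier_vec K"
  shows "norm2_vec (A *\<^sub>v y) \<le> norm_mat Frobenius A * norm2_vec y"
proof -
  have "norm2_vec (A *\<^sub>v y) = L2_set (\<lambda>i. cmod (\<Sum>j<K. A $$ (i, j) * y $ j)) {..<N}"
    unfolding norm2_vec_def using assms
    by (intro L2_set_cong) (auto simp: mult_mat_vec_nth[OF assms] simp del: index_mult_mat_vec)
  also have "\<dots> \<le> L2_set (\<lambda>i. L2_set (\<lambda>j. cmod (A $$ (i, j))) {..<K} * norm2_vec y) {..<N}"
    using assms by (intro L2_set_mono) (auto simp: norm2_vec_def intro: norm_sum_mult_le)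
  also have "\<dots> = L2_set (\<lambda>i. L2_set (\<lambda>j. cmod (A $$ (i, j))) {..<K}) {..<N} * norm2_vec y"
    by (simp add: L2_set_left_distrib)
  also have "L2_set (\<lambda>i. L2_set (\<lambda>j. cmod (A $$ (i, j))) {..<K}) {..<N} = norm_mat Frobenius A"
    using assms by (simp add: L2_set_def sum_nonneg sum.cartesian_product case_prod_unfold)
  finally show ?thesis .
qed

lemma Spectral_least:
  assumes "A \<in> carrier_mat N K"
    and "\<And>y. y \<in> carrier_vec K \<Longrightarrow> norm2_vec y \<le> 1 \<Longrightarrow> norm2_vec (A *\<^sub>v y) \<le> c"
  shows "norm_mat Spectral A \<le> c"
proof -
  have "0\<^sub>v K \<in> {v \<in> carrier_vec K. norm2_vec v \<le> 1}"
    by simp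
  then have "{v \<in> carrier_vec K. norm2_vec v \<le> 1} \<noteq> {}"
    by blast
  then have "(SUP v \<in> {v \<in> carrier_vec K. norm2_vec v \<le> 1}. norm2_vec (A *\<^sub>v v)) \<le> c"
    using assms(2) by (intro cSUP_least) auto
  then show ?thesis
    using assms(1) by simp
qed

text \<open>A value is below the supremum only once the values are known to be bounded above; on the
  unit ball the Frobenius norm is such a bound.\<close>

lemma Spectral_upper:
  assumes A: "A \<in> carrier_mat N K" and "y \<in> carrier_vec K" "norm2_vec y \<le> 1"
  shows "norm2_vec (A *\<^sub>v y) \<le> norm_mat Spectral A"
proof -
  have "bdd_above ((\<lambda>v. norm2_vec (A *\<^sub>v v)) ` {v \<in> carrier_vec K. norm2_vec v \<le> 1})"
  proof (rule bdd_aboveI2)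
    fix v assume v: "v \<in> {v \<in> carrier_vec K. norm2_vec v \<le> 1}"
    have "norm2_vec (A *\<^sub>v v) \<le> norm_mat Frobenius A * norm2_vec v"
      using v A by (intro norm2_mult_le_Frobenius) auto
    also have "\<dots> \<le> norm_mat Frobenius A * 1"
      using v by (intro mult_left_mono) auto
    finally show "norm2_vec (A *\<^sub>v v) \<le> norm_mat Frobenius A"
      by simp
  qed
  then show ?thesis
    using assms by (auto intro: cSUP_upper)
qed

lemma norm_mat_nonneg: "0 \<le> norm_mat M A"
proof (cases M)
  case Spectral
  have "norm2_vec (A *\<^sub>v 0\<^sub>v (dim_col A)) \<le> norm_mat Spectral A"
    by (rule Spectral_upper[of _ "dim_row A"]) auto
  then have "0 \<le> norm_mat Spectral A"
    by (rule order_trans[OF norm2_vec_nonneg])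
  with Spectral show ?thesis
    by simp
qed simp

lemma norm2_mult_le_Spectral:
  assumes A: "A \<in> carrier_mat N K" and y: "y \<in> carrier_vec K"
  shows "norm2_vec (A *\<^sub>v y) \<le> norm_mat Spectral A * norm2_vec y"
proof (cases "norm2_vec y = 0")
  case True
  then have "norm2_vec (A *\<^sub>v y) \<le> 0"
    using norm2_mult_le_Frobenius[OF assms] by simp
  with True show ?thesis
    by simp
next
  case False
  define s where "s = norm2_vec y"
  define e where "e = complex_of_real (1 / s) \<cdot>\<^sub>v y"
  have s: "s > 0"
    using False norm2_vec_nonneg[of y] unfolding s_def by linarith
  have e: "e \<in> carrier_vec K" "norm2_vec e = 1"
    using y s by (auto simp: e_def norm2_vec_smult norm_divide s_def)
  from e have "norm2_vec (A *\<^sub>v e) \<le> norm_mat Spectral A"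
    by (intro Spectral_upper[OF A]) auto
  also have "A *\<^sub>v e = complex_of_real (1 / s) \<cdot>\<^sub>v (A *\<^sub>v y)"
    unfolding e_def by (rule mult_mat_vec[OF A y])
  finally show ?thesis
    using s by (simp add: norm2_vec_smult norm_divide s_def field_simps)
qed

lemma norm2_mult_le:
  assumes "A \<in> carrier_mat N K" "y \<in> carrier_vec K"
  shows "norm2_vec (A *\<^sub>v y) \<le> norm_mat M A * norm2_vec y"
  using norm2_mult_le_Spectral[OF assms] norm2_mult_le_Frobenius[OF assms] by (cases M) auto

lemma norm_mat_add_le:
  assumes A: "A \<in> carrier_mat N K" and B: "B \<in> carrier_mat N K"
  shows "norm_mat M (A + B) \<le> norm_mat M A + norm_mat M B"
proof (cases M)
  case Spectral
  have "norm_mat Spectral (A + B) \<le> norm_mat Spectral A + norm_mat Spectral B"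
  proof (rule Spectral_least[of _ N K])
    fix y assume y: "y \<in> carrier_vec K" "norm2_vec y \<le> 1"
    have "norm2_vec ((A + B) *\<^sub>v y) = norm2_vec (A *\<^sub>v y + B *\<^sub>v y)"
      using A B y by (simp add: add_mult_distrib_mat_vec[of _ N K])
    also have "\<dots> \<le> norm2_vec (A *\<^sub>v y) + norm2_vec (B *\<^sub>v y)"
      using A B y by (intro norm2_vec_add_le[of _ N]) auto
    also have "\<dots> \<le> norm_mat Spectral A + norm_mat Spectral B"
      using A B y by (intro add_mono Spectral_upper) auto
    finally show "norm2_vec ((A + B) *\<^sub>v y) \<le> norm_mat Spectral A + norm_mat Spectral B" .
  qed (use A B in auto)
  with Spectral show ?thesis by simp
next
  case Frobenius
  have "L2_set (\<lambda>(i, j). cmod ((A + B) $$ (i, j))) ({..<N} \<times> {..<K})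
      = L2_set (\<lambda>p. cmod (A $$ p + B $$ p)) ({..<N} \<times> {..<K})"
    using A B by (intro L2_set_cong) auto
  with L2_set_norm_add_le[of "\<lambda>p. A $$ p" "\<lambda>p. B $$ p" "{..<N} \<times> {..<K}"] show ?thesis
    using A B Frobenius by (simp add: case_prod_unfold)
qed

lemma smult_mat_mult_vec: "y \<in> carrier_vec (dim_col A) \<Longrightarrow> (c \<cdot>\<^sub>m A) *\<^sub>v y = c \<cdot>\<^sub>v (A *\<^sub>v y)"
  for A :: "'a :: comm_semiring_0 mat"
  by (rule eq_vecI) (auto simp: scalar_prod_def sum_distrib_left mult_ac)

lemma norm_mat_smult_le: "norm_mat M (c \<cdot>\<^sub>m A) \<le> cmod c * norm_mat M A"
proof (cases M)
  case Spectral
  have A: "A \<in> carrier_mat (dim_row A) (dim_col A)" by simp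
  have "norm_mat Spectral (c \<cdot>\<^sub>m A) \<le> cmod c * norm_mat Spectral A"
  proof (rule Spectral_least[of _ "dim_row A" "dim_col A"])
    fix y assume y: "y \<in> carrier_vec (dim_col A)" "norm2_vec y \<le> 1"
    have "norm2_vec ((c \<cdot>\<^sub>m A) *\<^sub>v y) = cmod c * norm2_vec (A *\<^sub>v y)"
      using y by (simp add: smult_mat_mult_vec norm2_vec_smult)
    also have "\<dots> \<le> cmod c * norm_mat Spectral A"
      using Spectral_upper[OF A y] by (intro mult_left_mono) auto
    finally show "norm2_vec ((c \<cdot>\<^sub>m A) *\<^sub>v y) \<le> cmod c * norm_mat Spectral A" .
  qed simp
  with Spectral show ?thesis by simp
next
  case Frobenius
  have "L2_set (\<lambda>p. cmod ((c \<cdot>\<^sub>m A) $$ p)) ({..<dim_row A} \<times> {..<dim_col A})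
      = L2_set (\<lambda>p. cmod c * cmod (A $$ p)) ({..<dim_row A} \<times> {..<dim_col A})"
    by (intro L2_set_cong) (auto simp: norm_mult)
  with Frobenius show ?thesis
    by (simp add: case_prod_unfold L2_set_right_distrib)
qed

lemma norm_mat_zero [simp]: "norm_mat M (0\<^sub>m N K) = 0"
  using norm_mat_smult_le[of M 0 "0\<^sub>m N K"] norm_mat_nonneg[of M "0\<^sub>m N K"] by simp

section \<open>Norms of matrix polynomials and of their values at a point\<close>

definition power_norm :: "nat \<Rightarrow> complex \<Rightarrow> real" where
  "power_norm k lam = L2_set (\<lambda>j. cmod (lam ^ j)) {..k}"

lemma power_norm_pos: "0 < power_norm k lam"
proof -
  have "power_norm k lam \<noteq> 0"
    by (auto simp: power_norm_def L2_set_eq_0_iff intro: bexI[of _ 0])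
  then show ?thesis
    using L2_set_nonneg[of "\<lambda>j. cmod (lam ^ j)" "{..k}"] unfolding power_norm_def by linarith
qed

lemma power_norm_sq: "(power_norm k lam)\<^sup>2 = (\<Sum>j\<le>k. ((cmod lam)\<^sup>2) ^ j)"
  by (simp add: power_norm_def L2_set_def sum_nonneg norm_power power_mult[symmetric] mult.commute)

lemma norm_mp_eq_L2_set: "norm_mp M k Q = L2_set (\<lambda>j. norm_mat M (mp_coeff Q j)) {..k}"
  by (simp add: norm_mp_def L2_set_def)

lemma poly_eq_sum_le: "degree p \<le> k \<Longrightarrow> poly p z = (\<Sum>j\<le>k. coeff p j * z ^ j)"
  for p :: "'a :: comm_semiring_1 poly"
  unfolding poly_altdef by (rule sum.mono_neutral_left) (auto simp: coeff_eq_0)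

text \<open>The triangle inequality bounds the value by a sum of products of
  \<open>cmod (lam ^ l)\<close> with coefficient norms, and Cauchy--Schwarz separates the two
  sequences. This bounds from below every perturbation with a prescribed value at
  \<open>lam\<close>.\<close>

lemma norm_mat_eval_le:
  assumes "Q \<in> mat_polys k N"
  shows "norm_mat M (mp_eval Q lam) \<le> power_norm k lam * norm_mp M k Q"
proof -
  \<comment> \<open>The partial sums of the value at \<open>lam\<close>; the induction on
    \<open>d\<close> adds one coefficient at a time.\<close>
  define T where "T d = mat N N (\<lambda>(i, j). \<Sum>l<d. coeff (Q $$ (i, j)) l * lam ^ l)" for d
  have Q: "Q \<in> carrier_mat N N"
    using assms by (simp add: mat_polys_def)
  have T: "norm_mat M (T d) \<le> (\<Sum>l<d. cmod (lam ^ l) * norm_mat M (mp_coeff Q l))" for d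
  proof (induction d)
    case 0
    have "T 0 = 0\<^sub>m N N"
      by (auto simp: T_def)
    then show ?case by simp
  next
    case (Suc d)
    have "T (Suc d) = T d + lam ^ d \<cdot>\<^sub>m mp_coeff Q d"
      using Q by (auto simp: T_def mp_coeff_def mult.commute)
    then have "norm_mat M (T (Suc d)) \<le> norm_mat M (T d) + norm_mat M (lam ^ d \<cdot>\<^sub>m mp_coeff Q d)"
      using Q by (auto simp: T_def mp_coeff_def simp del: norm_mat.simps intro!: norm_mat_add_le[of _ N N])
    with Suc norm_mat_smult_le[of M "lam ^ d" "mp_coeff Q d"] show ?case
      by simp
  qed
  have "mp_eval Q lam = T (Suc k)"
    using assms Q
    by (auto simp: mp_eval_def T_def mat_polys_def poly_eq_sum_le lessThan_Suc_atMost simp del: sum.lessThan_Suc)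
  then have "norm_mat M (mp_eval Q lam) \<le> (\<Sum>l\<le>k. \<bar>cmod (lam ^ l)\<bar> * \<bar>norm_mat M (mp_coeff Q l)\<bar>)"
    using T[of "Suc k"] by (simp add: norm_mat_nonneg lessThan_Suc_atMost del: sum.lessThan_Suc norm_mat.simps)
  also have "\<dots> \<le> power_norm k lam * norm_mp M k Q"
    unfolding power_norm_def norm_mp_eq_L2_set by (rule L2_set_mult_ineq)
  finally show ?thesis .
qed

text \<open>Proportionality to \<open>cnj (lam ^ j)\<close> is the equality case of the Cauchy--Schwarz bound in
  \<open>norm_mat_eval_le\<close>.\<close>

definition spread_poly :: "nat \<Rightarrow> complex \<Rightarrow> complex poly" where
  "spread_poly k lam = (\<Sum>j\<le>k. monom (cnj (lam ^ j) / of_real ((power_norm k lam)\<^sup>2)) j)"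

lemma degree_spread_poly: "degree (spread_poly k lam) \<le> k"
  unfolding spread_poly_def by (intro degree_sum_le) (auto intro: order_trans[OF degree_monom_le])

lemma coeff_spread_poly:
  "j \<le> k \<Longrightarrow> coeff (spread_poly k lam) j = cnj (lam ^ j) / of_real ((power_norm k lam)\<^sup>2)"
  by (simp add: spread_poly_def coeff_sum)

lemma poly_spread_poly: "poly (spread_poly k lam) lam = 1"
proof -
  have "poly (spread_poly k lam) lam
      = (\<Sum>j\<le>k. lam ^ j * cnj (lam ^ j)) / of_real ((power_norm k lam)\<^sup>2)"
    by (simp add: spread_poly_def poly_sum poly_monom sum_divide_distrib mult.commute)
  also have "\<dots> = 1"
    using power_norm_pos[of k lam]
    unfolding of_real_L2_set_sq[symmetric] power_norm_def[symmetric] by simp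
  finally show ?thesis .
qed

text \<open>For square \<open>A\<close>, this has the least \<open>norm_mp\<close> among the matrix
  polynomials of grade \<open>k\<close> with value \<open>A\<close> at \<open>lam\<close>. Every
  coefficient is a multiple of \<open>A\<close>, so symmetry is inherited.\<close>

definition spread_mat :: "nat \<Rightarrow> complex \<Rightarrow> complex mat \<Rightarrow> complex poly mat" where
  "spread_mat k lam A = map_mat (\<lambda>a. smult a (spread_poly k lam)) A"

lemma spread_mat_in_mat_polys: "A \<in> carrier_mat N N \<Longrightarrow> spread_mat k lam A \<in> mat_polys k N"
  by (auto simp: spread_mat_def mat_polys_def intro!: order_trans[OF degree_smult_le] degree_spread_poly)

lemma mp_coeff_spread_mat: "mp_coeff (spread_mat k lam A) j = coeff (spread_poly k lam) j \<cdot>\<^sub>m A"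
  by (auto simp: mp_coeff_def spread_mat_def)

lemma spread_mat_in_sym_mat_polys:
  "A \<in> carrier_mat N N \<Longrightarrow> transpose_mat A = A \<Longrightarrow> spread_mat k lam A \<in> sym_mat_polys k N"
  by (auto simp: sym_mat_polys_def spread_mat_in_mat_polys mp_coeff_spread_mat
      transpose_mat_def mat_eq_iff)

lemma mp_eval_spread_mat: "mp_eval (spread_mat k lam A) lam = A"
  by (auto simp: mp_eval_def spread_mat_def poly_spread_poly)

lemma norm_mp_spread_mat_le: "norm_mp M k (spread_mat k lam A) \<le> norm_mat M A / power_norm k lam"
proof -
  define s where "s = power_norm k lam"
  have s: "s > 0"
    using power_norm_pos by (simp add: s_def)
  have "norm_mp M k (spread_mat k lam A) \<le> L2_set (\<lambda>j. cmod (lam ^ j) * (norm_mat M A / s\<^sup>2)) {..k}"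
    unfolding norm_mp_eq_L2_set mp_coeff_spread_mat
  proof (rule L2_set_mono)
    fix j assume "j \<in> {..k}"
    then have "cmod (coeff (spread_poly k lam) j) = cmod (lam ^ j) / s\<^sup>2"
      by (simp add: coeff_spread_poly norm_divide norm_power s_def)
    with norm_mat_smult_le[of M "coeff (spread_poly k lam) j" A]
    show "norm_mat M (coeff (spread_poly k lam) j \<cdot>\<^sub>m A) \<le> cmod (lam ^ j) * (norm_mat M A / s\<^sup>2)"
      by simp
  qed (rule norm_mat_nonneg)
  also have "\<dots> = s * (norm_mat M A / s\<^sup>2)"
    unfolding s_def power_norm_def by (rule L2_set_left_distrib[symmetric]) (simp add: norm_mat_nonneg)
  also have "\<dots> = norm_mat M A / s"
    using s by (simp add: power2_eq_square)
  finally show ?thesis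
    by (simp add: s_def)
qed

text \<open>By \<open>least\<close> and \<open>norm_mat_eval_le\<close> every admissible
  perturbation is bounded from below, and \<open>spread_mat k lam A\<close> attains the bound, so
  the infimum is a minimum. What remains is a problem about single matrices that send
  \<open>u\<close> to minus the residual.\<close>

lemma structured_backward_error_eqI:
  assumes Q: "Q \<in> carrier_mat N N" and u: "u \<in> carrier_vec N" and A: "A \<in> carrier_mat N N"
    and Au: "A *\<^sub>v u = - (mp_eval Q lam *\<^sub>v u)"
    and S: "S \<subseteq> mat_polys k N" and AS: "spread_mat k lam A \<in> S"
    and least: "\<And>\<Delta>. \<Delta> \<in> S \<Longrightarrow> mp_eval \<Delta> lam *\<^sub>v u = - (mp_eval Q lam *\<^sub>v u)
      \<Longrightarrow> norm_mat M A \<le> norm_mat M (mp_eval \<Delta> lam)"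
  shows "structured_backward_error M S k lam u Q = norm_mat M A / power_norm k lam"
proof -
  let ?r = "mp_eval Q lam *\<^sub>v u"
  have r: "?r \<in> carrier_vec N"
    using Q u by (auto simp: mp_eval_def intro!: mult_mat_vec_carrier)
  have lower: "norm_mat M A / power_norm k lam \<le> norm_mp M k \<Delta>"
    if D: "\<Delta> \<in> S" and eq: "?r + mp_eval \<Delta> lam *\<^sub>v u = 0\<^sub>v N" for \<Delta>
  proof -
    have \<Delta>: "\<Delta> \<in> mat_polys k N"
      using S D by blast
    have d: "mp_eval \<Delta> lam *\<^sub>v u \<in> carrier_vec N"
      using \<Delta> u by (auto simp: mp_eval_def mat_polys_def intro!: mult_mat_vec_carrier)
    have "mp_eval \<Delta> lam *\<^sub>v u = - ?r"
    proof (rule eq_vecI)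
      fix i assume "i < dim_vec (- ?r)"
      then have i: "i < N" using carrier_vecD[OF r] by simp
      have "(?r + mp_eval \<Delta> lam *\<^sub>v u) $ i = 0"
        using eq i by simp
      then show "(mp_eval \<Delta> lam *\<^sub>v u) $ i = (- ?r) $ i"
        using i carrier_vecD[OF r] carrier_vecD[OF d]
        by (simp del: index_mult_mat_vec dim_mult_mat_vec add: add_eq_0_iff)
    qed (use carrier_vecD[OF r] carrier_vecD[OF d] in simp)
    from least[OF D this] norm_mat_eval_le[OF \<Delta>, of M lam]
    have "norm_mat M A \<le> power_norm k lam * norm_mp M k \<Delta>"
      by (rule order_trans)
    then show ?thesis
      using power_norm_pos[of k lam] by (simp add: field_simps)
  qed
  have feas: "?r + mp_eval (spread_mat k lam A) lam *\<^sub>v u = 0\<^sub>v N"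
    using r by (simp add: mp_eval_spread_mat Au)
  have "norm_mp M k (spread_mat k lam A) = norm_mat M A / power_norm k lam"
    using lower[OF AS feas] norm_mp_spread_mat_le by (rule antisym[rotated])
  then show ?thesis
    unfolding structured_backward_error_def
    using Q AS feas lower by (intro cInf_eq_minimum) force+
qed

subsection \<open>Minimal matrices mapping one vector to another\<close>

lemma L2_set_prod: "L2_set (\<lambda>(i, j). f i * g j) (I \<times> J) = L2_set f I * L2_set g J"
  by (simp add: L2_set_def case_prod_unfold power_mult_distrib real_sqrt_mult[symmetric]
      sum_product sum.cartesian_product)

lemma of_real_norm2_vec_sq:
  "v \<in> carrier_vec N \<Longrightarrow> complex_of_real ((norm2_vec v)\<^sup>2) = (\<Sum>i<N. v $ i * cnj (v $ i))"
  unfolding norm2_vec_def of_real_L2_set_sq by auto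

text \<open>The witness is w u^H / |u|^2. Its Frobenius norm factors into the norms of
  \<open>w\<close> and \<open>u\<close> and dominates its spectral norm, so one \<open>A\<close>
  serves both norms.\<close>

lemma rank_one_map:
  assumes u: "u \<in> carrier_vec N" "u \<noteq> 0\<^sub>v N" and w: "w \<in> carrier_vec N"
  obtains A where "A \<in> carrier_mat N N" "A *\<^sub>v u = w"
    "\<And>M. norm_mat M A \<le> norm2_vec w / norm2_vec u"
proof
  define s where "s = (norm2_vec u)\<^sup>2"
  have s: "s \<noteq> 0"
    using u by (simp add: s_def norm2_vec_eq_0_iff)
  let ?A = "mat N N (\<lambda>(i, j). w $ i * cnj (u $ j) / of_real s)"
  show A: "?A \<in> carrier_mat N N" by simp
  show "?A *\<^sub>v u = w"
  proof (rule eq_vecI)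
    fix i assume "i < dim_vec w"
    then have i: "i < N" using w by simp
    then have "(?A *\<^sub>v u) $ i = w $ i / of_real s * (\<Sum>j<N. u $ j * cnj (u $ j))"
      by (simp add: mult_mat_vec_nth[OF A u(1)] sum_distrib_left mult_ac del: index_mult_mat_vec)
    then show "(?A *\<^sub>v u) $ i = w $ i"
      using s by (simp add: of_real_norm2_vec_sq[OF u(1), symmetric] s_def)
  qed (use w in simp)
  have "norm_mat Frobenius ?A
      = L2_set (\<lambda>(i, j). cmod (w $ i) * (cmod (u $ j) / s)) ({..<N} \<times> {..<N})"
    by (auto intro!: L2_set_cong simp: norm_mult norm_divide norm_power s_def)
  also have "\<dots> = norm2_vec w * (norm2_vec u / s)"
    using u w by (simp add: L2_set_prod divide_inverse L2_set_left_distrib[symmetric] norm2_vec_def s_def)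
  also have "\<dots> = norm2_vec w / norm2_vec u"
    using s by (simp add: s_def power2_eq_square)
  finally have F: "norm_mat Frobenius ?A = norm2_vec w / norm2_vec u" .
  show "norm_mat M ?A \<le> norm2_vec w / norm2_vec u" for M
  proof (cases M)
    case Spectral
    have "norm_mat Spectral ?A \<le> norm_mat Frobenius ?A"
    proof (rule Spectral_least[OF A])
      fix y assume y: "y \<in> carrier_vec N" "norm2_vec y \<le> 1"
      have "norm2_vec (?A *\<^sub>v y) \<le> norm_mat Frobenius ?A * norm2_vec y"
        by (rule norm2_mult_le_Frobenius[OF A y(1)])
      also have "\<dots> \<le> norm_mat Frobenius ?A"
        by (rule mult_left_le[OF y(2) norm_mat_nonneg])
      finally show "norm2_vec (?A *\<^sub>v y) \<le> norm_mat Frobenius ?A" .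
    qed
    with F Spectral show ?thesis by simp
  qed (use F in simp)
qed

text \<open>With \<open>t\<close> the component of \<open>w\<close> orthogonal to the conjugate of \<open>u\<close>, the witness below is
  the Davis--Kahan--Weinberger dilation: for unit \<open>u\<close> and \<open>w\<close> it maps the orthonormal pair
  \<open>u, cnj t / |t|\<close> to the pair \<open>cnj u, t / |t|\<close> by the symmetric unitary matrix with rows
  \<open>(c, |t|)\<close> and \<open>(|t|, - cnj c)\<close>, and it vanishes on the complement. If \<open>t = 0\<close>, then
  \<open>\<tau> = 0\<close> and the junk value of \<open>cnj c / (\<alpha> * \<tau>)\<close> is harmless.\<close>

lemma symmetric_contraction:
  assumes u: "u \<in> carrier_vec N" "u \<noteq> 0\<^sub>v N" and w: "w \<in> carrier_vec N"
  obtains A where "A \<in> carrier_mat N N" "transpose_mat A = A" "A *\<^sub>v u = w"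
    "norm_mat Spectral A \<le> norm2_vec w / norm2_vec u"
proof
  define \<alpha> where "\<alpha> = (norm2_vec u)\<^sup>2"
  define \<beta> where "\<beta> = (norm2_vec w)\<^sup>2"
  define c where "c = (\<Sum>i<N. u $ i * w $ i)"
  define t where "t i = w $ i - c / of_real \<alpha> * cnj (u $ i)" for i
  define \<tau> where "\<tau> = (L2_set (\<lambda>i. cmod (t i)) {..<N})\<^sup>2"
  have \<alpha>: "\<alpha> > 0"
    using u by (simp add: \<alpha>_def norm2_vec_eq_0_iff)
  have uu: "(\<Sum>i<N. u $ i * cnj (u $ i)) = of_real \<alpha>"
    by (simp only: of_real_norm2_vec_sq[OF u(1), symmetric] \<alpha>_def)
  have tu: "(\<Sum>i<N. t i * u $ i) = 0"
  proof -
    have "(\<Sum>i<N. t i * u $ i) = c - c / of_real \<alpha> * (\<Sum>i<N. u $ i * cnj (u $ i))"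
      unfolding t_def c_def sum_distrib_left sum_subtractf[symmetric]
      by (intro sum.cong refl) (simp add: algebra_simps)
    then show ?thesis
      using \<alpha> by (simp add: uu)
  qed
  have ut: "(\<Sum>i<N. cnj (u $ i) * cnj (t i)) = 0"
    using arg_cong[OF tu, of cnj] by (simp add: mult.commute)
  \<comment> \<open>The vector \<open>w\<close> is a multiple of the conjugate of \<open>u\<close>
    plus \<open>t\<close>; these are orthogonal by \<open>ut\<close>, so squared lengths
    add.\<close>
  have \<beta>: "\<beta> = \<tau> + (cmod c)\<^sup>2 / \<alpha>"
  proof -
    have "\<beta> = (L2_set (\<lambda>i. cmod (c / of_real \<alpha> * cnj (u $ i) + 1 * t i)) {..<N})\<^sup>2"
      using w by (simp add: \<beta>_def norm2_vec_def t_def)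
    also have "\<dots> = (cmod (c / of_real \<alpha>))\<^sup>2 * \<alpha> + \<tau>"
      by (subst L2_set_pythagoras[OF ut]) (use u in \<open>simp add: \<alpha>_def \<tau>_def norm2_vec_def\<close>)
    also have "(cmod (c / of_real \<alpha>))\<^sup>2 * \<alpha> = (cmod c)\<^sup>2 / \<alpha>"
      using \<alpha> by (simp add: norm_divide power_divide power2_eq_square)
    finally show ?thesis by simp
  qed
  let ?A = "mat N N (\<lambda>(i, j). c / of_real (\<alpha>\<^sup>2) * (cnj (u $ i) * cnj (u $ j))
      + (t i * cnj (u $ j) + cnj (u $ i) * t j) / of_real \<alpha>
      - cnj c / of_real (\<alpha> * \<tau>) * (t i * t j))"
  show A: "?A \<in> carrier_mat N N" by simp
  show "transpose_mat ?A = ?A"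
    by (rule eq_matI) (auto simp: algebra_simps)
  \<comment> \<open>Only the coordinates \<open>a\<close> and \<open>b\<close> of \<open>y\<close>
    enter, and the image lies in the span of the conjugate of \<open>u\<close> and \<open>t\<close>.
    The norm bound thereby becomes a two-dimensional computation.\<close>
  have Ay: "(?A *\<^sub>v y) $ i
      = (c * a / of_real (\<alpha>\<^sup>2) + b / of_real \<alpha>) * cnj (u $ i)
        + (a / of_real \<alpha> - cnj c * b / of_real (\<alpha> * \<tau>)) * t i"
    if y: "y \<in> carrier_vec N" and i: "i < N"
      and a: "a = (\<Sum>j<N. y $ j * cnj (u $ j))" and b: "b = (\<Sum>j<N. y $ j * t j)"
    for y i a b
  proof -
    have "(?A *\<^sub>v y) $ i = (\<Sum>j<N. (c / of_real (\<alpha>\<^sup>2) * cnj (u $ i) + t i / of_real \<alpha>) * (y $ j * cnj (u $ j))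
        + (cnj (u $ i) / of_real \<alpha> - cnj c / of_real (\<alpha> * \<tau>) * t i) * (y $ j * t j))"
      unfolding mult_mat_vec_nth[OF A y i] using i
      by (intro sum.cong refl) (simp add: algebra_simps add_divide_distrib)
    also have "\<dots> = (c / of_real (\<alpha>\<^sup>2) * cnj (u $ i) + t i / of_real \<alpha>) * a
        + (cnj (u $ i) / of_real \<alpha> - cnj c / of_real (\<alpha> * \<tau>) * t i) * b"
      by (simp only: sum.distrib sum_distrib_left[symmetric] a b)
    finally show ?thesis
      by (simp add: algebra_simps)
  qed
  show "?A *\<^sub>v u = w"
  proof (rule eq_vecI)
    fix i assume "i < dim_vec w"
    then have i: "i < N" using w by simp
    have "(\<Sum>j<N. u $ j * t j) = 0"
      using tu by (simp add: mult.commute)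
    from Ay[OF u(1) i uu[symmetric] this[symmetric]] \<alpha>
    have "(?A *\<^sub>v u) $ i = c / of_real \<alpha> * cnj (u $ i) + t i"
      by (simp add: power2_eq_square)
    then show "(?A *\<^sub>v u) $ i = w $ i"
      by (simp add: t_def)
  qed (use w in simp)
  show "norm_mat Spectral ?A \<le> norm2_vec w / norm2_vec u"
  proof (rule Spectral_least[OF A])
    fix y :: "complex vec" assume y: "y \<in> carrier_vec N" "norm2_vec y \<le> 1"
    define a where "a = (\<Sum>j<N. y $ j * cnj (u $ j))"
    define b where "b = (\<Sum>j<N. y $ j * t j)"
    define p where "p = c * a / of_real (\<alpha>\<^sup>2) + b / of_real \<alpha>"
    define q where "q = a / of_real \<alpha> - cnj c * b / of_real (\<alpha> * \<tau>)"
    have b0: "b = 0" if "\<tau> = 0"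
      using that by (simp add: \<tau>_def b_def L2_set_eq_0_iff)
    have "norm2_vec (?A *\<^sub>v y) = L2_set (\<lambda>i. cmod (p * cnj (u $ i) + q * t i)) {..<N}"
      unfolding norm2_vec_def p_def q_def
      using Ay[OF y(1) _ a_def b_def] by (intro L2_set_cong) (auto simp del: index_mult_mat_vec)
    then have "(norm2_vec (?A *\<^sub>v y))\<^sup>2 = (cmod p)\<^sup>2 * \<alpha> + (cmod q)\<^sup>2 * \<tau>"
      using L2_set_pythagoras[OF ut, of p q] u by (simp add: \<alpha>_def \<tau>_def norm2_vec_def)
    \<comment> \<open>For nonzero \<tau> the cross terms of the two squares cancel, which reflects
      that the 2 by 2 block is a multiple of a unitary matrix. For \<tau> = 0 the terms with
      \<open>b\<close> vanish by \<open>b0\<close>.\<close>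
    also have "\<dots> = \<beta> / \<alpha> * ((cmod a)\<^sup>2 / \<alpha> + (cmod b)\<^sup>2 / \<tau>)"
    proof -
      have "complex_of_real ((cmod p)\<^sup>2 * \<alpha> + (cmod q)\<^sup>2 * \<tau>)
          = complex_of_real ((\<tau> + (cmod c)\<^sup>2 / \<alpha>) / \<alpha> * ((cmod a)\<^sup>2 / \<alpha> + (cmod b)\<^sup>2 / \<tau>))"
      proof (cases "\<tau> = 0")
        case True
        then show ?thesis
          using \<alpha> b0
          unfolding of_real_add of_real_mult of_real_divide complex_norm_square p_def q_def
          by (simp add: field_simps power2_eq_square)
      next
        case False
        then show ?thesis
          using \<alpha>
          unfolding of_real_add of_real_mult of_real_divide complex_norm_square p_def q_def
          by (simp add: field_simps power2_eq_square)
      qed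
      then show ?thesis
        unfolding \<beta> by (simp only: of_real_eq_iff)
    qed
    also have "\<dots> \<le> \<beta> / \<alpha> * (norm2_vec y)\<^sup>2"
    proof (intro mult_left_mono)
      have "(\<Sum>i<N. u $ i * cnj (cnj (t i))) = 0"
        using tu by (simp add: mult.commute)
      from L2_set_bessel[OF _ this, of "\<lambda>i. y $ i"] u y
      show "(cmod a)\<^sup>2 / \<alpha> + (cmod b)\<^sup>2 / \<tau> \<le> (norm2_vec y)\<^sup>2"
        by (simp add: a_def b_def \<alpha>_def \<tau>_def norm2_vec_def)
    qed (use \<alpha> in \<open>simp add: \<beta>_def\<close>)
    also have "\<dots> \<le> \<beta> / \<alpha> * 1"
      using y \<alpha> by (intro mult_left_mono) (auto simp: \<beta>_def power_le_one)
    finally have "(norm2_vec (?A *\<^sub>v y))\<^sup>2 \<le> (norm2_vec w / norm2_vec u)\<^sup>2"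
      by (simp add: \<alpha>_def \<beta>_def power_divide)
    then show "norm2_vec (?A *\<^sub>v y) \<le> norm2_vec w / norm2_vec u"
      by (rule power2_le_imp_le) simp
  qed
qed

text \<open>The witness \<open>A\<close> is characterised by the fact that \<open>B \<bullet> A\<close> takes the same value \<open>K\<close> for all
  symmetric solutions \<open>B\<close>, including \<open>A\<close> itself; minimality is then Cauchy--Schwarz.\<close>

lemma symmetric_min_Frobenius:
  assumes u: "u \<in> carrier_vec N" "u \<noteq> 0\<^sub>v N" and w: "w \<in> carrier_vec N"
  obtains A where "A \<in> carrier_mat N N" "transpose_mat A = A" "A *\<^sub>v u = w"
    "norm_mat Frobenius A = sqrt (2 * (norm2_vec w)\<^sup>2
       - (cmod (\<Sum>i<N. u $ i * w $ i))\<^sup>2 / (norm2_vec u)\<^sup>2) / norm2_vec u"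
    "\<And>B. B \<in> carrier_mat N N \<Longrightarrow> transpose_mat B = B \<Longrightarrow> B *\<^sub>v u = w
       \<Longrightarrow> norm_mat Frobenius A \<le> norm_mat Frobenius B"
proof
  define s where "s = (norm2_vec u)\<^sup>2"
  define c where "c = (\<Sum>i<N. u $ i * w $ i)"
  define K where "K = (2 * (norm2_vec w)\<^sup>2 - (cmod c)\<^sup>2 / s) / s"
  have s: "s > 0"
    using u by (simp add: s_def norm2_vec_eq_0_iff)
  have uu: "(\<Sum>i<N. u $ i * cnj (u $ i)) = of_real s"
    by (simp only: of_real_norm2_vec_sq[OF u(1), symmetric] s_def)
  have ww: "(\<Sum>i<N. w $ i * cnj (w $ i)) = (of_real (norm2_vec w))\<^sup>2"
    by (simp only: of_real_norm2_vec_sq[OF w, symmetric] of_real_power)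
  \<comment> \<open>The first, symmetrised term sends \<open>u\<close> to \<open>w\<close> plus
    \<open>c / s\<close> times the conjugate of \<open>u\<close>; the last term removes this
    surplus.\<close>
  let ?A = "mat N N (\<lambda>(i, j). (w $ i * cnj (u $ j) + cnj (u $ i) * w $ j) / of_real s
      - c / of_real (s\<^sup>2) * (cnj (u $ i) * cnj (u $ j)))"
  let ?I = "{..<N} \<times> {..<N}"
  show A: "?A \<in> carrier_mat N N" by simp
  show At: "transpose_mat ?A = ?A"
    by (rule eq_matI) (auto simp: algebra_simps)
  show Au: "?A *\<^sub>v u = w"
  proof (rule eq_vecI)
    fix i assume "i < dim_vec w"
    then have i: "i < N" using w by simp
    have "(?A *\<^sub>v u) $ i
        = (\<Sum>j<N. (w $ i / of_real s - c / of_real (s\<^sup>2) * cnj (u $ i)) * (u $ j * cnj (u $ j))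
            + cnj (u $ i) / of_real s * (u $ j * w $ j))"
      unfolding mult_mat_vec_nth[OF A u(1) i] using i
      by (intro sum.cong refl) (simp add: algebra_simps add_divide_distrib)
    also have "\<dots> = (w $ i / of_real s - c / of_real (s\<^sup>2) * cnj (u $ i)) * of_real s + cnj (u $ i) / of_real s * c"
      by (simp only: sum.distrib sum_distrib_left[symmetric] uu c_def)
    also have "\<dots> = w $ i"
      using s by (simp add: field_simps power2_eq_square)
    finally show "(?A *\<^sub>v u) $ i = w $ i" .
  qed (use w in simp)
  have F: "norm_mat Frobenius B = L2_set (\<lambda>p. cmod (B $$ p)) ?I" if "B \<in> carrier_mat N N" for B
    using that by (simp add: case_prod_unfold)
  have inner: "(\<Sum>p\<in>?I. B $$ p * cnj (?A $$ p)) = of_real K"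
    if B: "B \<in> carrier_mat N N" and Bt: "transpose_mat B = B" and Bu: "B *\<^sub>v u = w" for B
  proof -
    have sym: "B $$ (i, j) = B $$ (j, i)" if "i < N" "j < N" for i j
      using that B arg_cong[OF Bt, of "\<lambda>C. C $$ (i, j)"] by simp
    have row: "(\<Sum>j<N. B $$ (i, j) * u $ j) = w $ i" if "i < N" for i
      using mult_mat_vec_nth[OF B u(1) that] Bu by simp
    \<comment> \<open>Symmetry enters here: the transpose of \<open>B\<close> also sends
      \<open>u\<close> to \<open>w\<close>. Hence the values of the sums \<open>1\<close>,
      \<open>2\<close> and \<open>3\<close> no longer depend on \<open>B\<close>.\<close>
    have col: "(\<Sum>i<N. B $$ (i, j) * u $ i) = w $ j" if "j < N" for j
      unfolding row[OF that, symmetric] using that by (intro sum.cong refl) (simp add: sym)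
    have 1: "(\<Sum>i<N. \<Sum>j<N. cnj (w $ i) * (B $$ (i, j) * u $ j)) = (of_real (norm2_vec w))\<^sup>2"
      unfolding ww[symmetric] sum_distrib_left[symmetric] by (intro sum.cong refl) (simp add: row)
    have 2: "(\<Sum>i<N. \<Sum>j<N. cnj (w $ j) * (B $$ (i, j) * u $ i)) = (of_real (norm2_vec w))\<^sup>2"
      unfolding ww[symmetric]
      by (subst sum.swap, unfold sum_distrib_left[symmetric], intro sum.cong refl) (simp add: col)
    have 3: "(\<Sum>i<N. \<Sum>j<N. u $ i * (B $$ (i, j) * u $ j)) = c"
      unfolding c_def sum_distrib_left[symmetric] by (intro sum.cong refl) (simp add: row)
    have "(\<Sum>p\<in>?I. B $$ p * cnj (?A $$ p)) = (\<Sum>i<N. \<Sum>j<N. B $$ (i, j) * cnj (?A $$ (i, j)))"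
      unfolding sum.cartesian_product by (intro sum.cong refl) auto
    also have "\<dots> = (\<Sum>i<N. \<Sum>j<N.
          1 / of_real s * (cnj (w $ i) * (B $$ (i, j) * u $ j))
        + 1 / of_real s * (cnj (w $ j) * (B $$ (i, j) * u $ i))
        - cnj c / of_real (s\<^sup>2) * (u $ i * (B $$ (i, j) * u $ j)))"
      by (intro sum.cong refl) (simp add: algebra_simps add_divide_distrib)
    also have "\<dots> = 1 / of_real s * (of_real (norm2_vec w))\<^sup>2 + 1 / of_real s * (of_real (norm2_vec w))\<^sup>2
        - cnj c / of_real (s\<^sup>2) * c"
      unfolding sum.distrib sum_subtractf sum_distrib_left[symmetric] 2
        1[unfolded sum_distrib_left[symmetric]] 3[unfolded sum_distrib_left[symmetric]] ..
    also have "\<dots> = of_real K"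
      unfolding K_def of_real_divide of_real_diff of_real_mult complex_norm_square
      by (simp add: diff_divide_distrib power2_eq_square mult_ac)
    finally show ?thesis .
  qed
  have A2: "(norm_mat Frobenius ?A)\<^sup>2 = K"
  proof -
    have "complex_of_real ((norm_mat Frobenius ?A)\<^sup>2) = of_real K"
      unfolding F[OF A] of_real_L2_set_sq by (rule inner[OF A At Au])
    then show ?thesis
      by (simp only: of_real_eq_iff)
  qed
  have K: "0 \<le> K"
    unfolding A2[symmetric] by (rule zero_le_power2)
  have "norm_mat Frobenius ?A = sqrt K"
    by (rule real_sqrt_unique[OF A2 norm_mat_nonneg, symmetric])
  then show "norm_mat Frobenius ?A = sqrt (2 * (norm2_vec w)\<^sup>2
       - (cmod (\<Sum>i<N. u $ i * w $ i))\<^sup>2 / (norm2_vec u)\<^sup>2) / norm2_vec u"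
    by (simp only: K_def s_def c_def real_sqrt_divide real_sqrt_abs abs_of_nonneg[OF norm2_vec_nonneg])
  fix B assume B: "B \<in> carrier_mat N N" "transpose_mat B = B" "B *\<^sub>v u = w"
  have "(norm_mat Frobenius ?A)\<^sup>2 = cmod (\<Sum>p\<in>?I. B $$ p * cnj (?A $$ p))"
    unfolding inner[OF B] A2 norm_of_real by (rule abs_of_nonneg[OF K, symmetric])
  also have "\<dots> \<le> norm_mat Frobenius B * norm_mat Frobenius ?A"
    unfolding F[OF A] F[OF B(1)]
    using norm_sum_mult_le[of "\<lambda>p. B $$ p" "\<lambda>p. cnj (?A $$ p)" ?I] by (simp only: complex_mod_cnj)
  finally have le: "norm_mat Frobenius ?A * norm_mat Frobenius ?A
      \<le> norm_mat Frobenius B * norm_mat Frobenius ?A"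
    unfolding power2_eq_square .
  show "norm_mat Frobenius ?A \<le> norm_mat Frobenius B"
  proof (cases "0 < norm_mat Frobenius ?A")
    case True
    with le show ?thesis
      by (rule mult_right_le_imp_le)
  next
    case False
    then show ?thesis
      by (rule order_trans[OF leI norm_mat_nonneg])
  qed
qed

subsection \<open>Backward error formulas\<close>

lemma mp_eval_mult_carrier:
  assumes "Q \<in> carrier_mat N N" "u \<in> carrier_vec N"
  shows "mp_eval Q lam *\<^sub>v u \<in> carrier_vec N"
  using assms by (auto simp: mp_eval_def intro!: mult_mat_vec_carrier)

lemma norm2_vec_pos: "u \<in> carrier_vec N \<Longrightarrow> u \<noteq> 0\<^sub>v N \<Longrightarrow> 0 < norm2_vec u"
  using norm2_vec_nonneg[of u] norm2_vec_eq_0_iff[of u N] by linarith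

text \<open>Both norms dominate the stretching of \<open>u\<close>. The witness of
  \<open>rank_one_map\<close> meets this bound in either norm, that of
  \<open>symmetric_contraction\<close> in the spectral norm, so they are minimal.\<close>

lemma norm_mat_ge_residual:
  assumes B: "B \<in> carrier_mat N N" and u: "u \<in> carrier_vec N" "u \<noteq> 0\<^sub>v N" and Bu: "B *\<^sub>v u = - r"
  shows "norm2_vec r / norm2_vec u \<le> norm_mat M B"
  using norm2_mult_le[OF B u(1), of M] norm2_vec_pos[OF u] unfolding Bu
  by (simp add: divide_le_eq del: norm_mat.simps)

lemma mp_eval_carrier: "\<Delta> \<in> mat_polys k N \<Longrightarrow> mp_eval \<Delta> lam \<in> carrier_mat N N"
  by (simp add: mat_polys_def mp_eval_def)

text \<open>The rank-one witness has the minimal norm |r| / |u| for each choice of \<open>M\<close>,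
  hence a formula independent of \<open>M\<close>.\<close>

lemma backward_error_eq:
  assumes Q: "Q \<in> carrier_mat N N" and u: "u \<in> carrier_vec N" "u \<noteq> 0\<^sub>v N"
  shows "backward_error M k lam u Q
    = norm2_vec (mp_eval Q lam *\<^sub>v u) / norm2_vec u / power_norm k lam"
proof -
  let ?r = "mp_eval Q lam *\<^sub>v u"
  have r: "?r \<in> carrier_vec N"
    using Q u by (intro mp_eval_mult_carrier)
  then have r': "- ?r \<in> carrier_vec N"
    by simp
  obtain A where A: "A \<in> carrier_mat N N" "A *\<^sub>v u = - ?r"
    "norm_mat M A \<le> norm2_vec (- ?r) / norm2_vec u"
    using rank_one_map[OF u r'] by metis
  have "norm2_vec ?r / norm2_vec u \<le> norm_mat M A"
    by (rule norm_mat_ge_residual[OF A(1) u A(2)])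
  with A(3) have eq: "norm_mat M A = norm2_vec ?r / norm2_vec u"
    by (simp only: norm2_vec_uminus)
  have "structured_backward_error M (mat_polys k N) k lam u Q = norm_mat M A / power_norm k lam"
    by (rule structured_backward_error_eqI[OF Q u(1) A(1,2) order_refl spread_mat_in_mat_polys[OF A(1)]])
      (unfold eq, rule norm_mat_ge_residual[OF mp_eval_carrier u])
  moreover have "dim_row Q = N"
    using Q by simp
  ultimately show ?thesis
    unfolding backward_error_def by (simp only: eq)
qed

lemma sym_mat_polys_subset: "sym_mat_polys k N \<subseteq> mat_polys k N"
  by (auto simp: sym_mat_polys_def)

text \<open>Since \<open>sym_mat_polys\<close> constrains the coefficients up to \<open>k\<close>,
  the degree bound is what makes these all of them. The result lets admissible perturbations enter
  the minimality statement of \<open>symmetric_min_Frobenius\<close>.\<close>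

lemma transpose_mp_eval:
  assumes "\<Delta> \<in> sym_mat_polys k N"
  shows "transpose_mat (mp_eval \<Delta> lam) = mp_eval \<Delta> lam"
proof (rule eq_matI)
  have \<Delta>: "\<Delta> \<in> carrier_mat N N" and deg: "\<And>i j. i < N \<Longrightarrow> j < N \<Longrightarrow> degree (\<Delta> $$ (i, j)) \<le> k"
    using assms by (auto simp: sym_mat_polys_def mat_polys_def)
  fix i j assume "i < dim_row (mp_eval \<Delta> lam)" "j < dim_col (mp_eval \<Delta> lam)"
  then have ij: "i < N" "j < N"
    using \<Delta> by (auto simp: mp_eval_def)
  have "coeff (\<Delta> $$ (j, i)) l = coeff (\<Delta> $$ (i, j)) l" if "l \<le> k" for l
  proof -
    have "transpose_mat (mp_coeff \<Delta> l) $$ (i, j) = mp_coeff \<Delta> l $$ (i, j)"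
      using assms that by (simp add: sym_mat_polys_def)
    then show ?thesis
      using ij \<Delta> by (simp add: mp_coeff_def)
  qed
  then show "transpose_mat (mp_eval \<Delta> lam) $$ (i, j) = mp_eval \<Delta> lam $$ (i, j)"
    using ij \<Delta> by (simp add: mp_eval_def poly_eq_sum_le[OF deg])
qed (use assms in \<open>auto simp: mp_eval_def sym_mat_polys_def mat_polys_def\<close>)

lemma symmetric_backward_error_Spectral:
  assumes Q: "Q \<in> carrier_mat N N" and u: "u \<in> carrier_vec N" "u \<noteq> 0\<^sub>v N"
  shows "structured_backward_error Spectral (sym_mat_polys k N) k lam u Q
    = norm2_vec (mp_eval Q lam *\<^sub>v u) / norm2_vec u / power_norm k lam"
proof -
  let ?r = "mp_eval Q lam *\<^sub>v u"
  have r: "?r \<in> carrier_vec N"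
    using Q u by (intro mp_eval_mult_carrier)
  then have r': "- ?r \<in> carrier_vec N"
    by simp
  obtain A where A: "A \<in> carrier_mat N N" "transpose_mat A = A" "A *\<^sub>v u = - ?r"
    "norm_mat Spectral A \<le> norm2_vec (- ?r) / norm2_vec u"
    using symmetric_contraction[OF u r'] by metis
  have "norm2_vec ?r / norm2_vec u \<le> norm_mat Spectral A"
    by (rule norm_mat_ge_residual[OF A(1) u A(3)])
  with A(4) have eq: "norm_mat Spectral A = norm2_vec ?r / norm2_vec u"
    by (simp only: norm2_vec_uminus)
  have "structured_backward_error Spectral (sym_mat_polys k N) k lam u Q
      = norm_mat Spectral A / power_norm k lam"
    by (rule structured_backward_error_eqI[OF Q u(1) A(1,3) sym_mat_polys_subset
          spread_mat_in_sym_mat_polys[OF A(1,2)]])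
      (unfold eq, rule norm_mat_ge_residual[OF mp_eval_carrier[OF subsetD[OF sym_mat_polys_subset]] u])
  then show ?thesis
    by (simp only: eq)
qed

lemma symmetric_backward_error_Frobenius:
  assumes Q: "Q \<in> carrier_mat N N" and u: "u \<in> carrier_vec N" "u \<noteq> 0\<^sub>v N"
    and r_def: "r = mp_eval Q lam *\<^sub>v u"
  shows "structured_backward_error Frobenius (sym_mat_polys k N) k lam u Q
    = sqrt (2 * (norm2_vec r)\<^sup>2 - (cmod (\<Sum>i<N. u $ i * r $ i))\<^sup>2 / (norm2_vec u)\<^sup>2)
      / norm2_vec u / power_norm k lam"
proof -
  have r: "r \<in> carrier_vec N"
    unfolding r_def using Q u by (intro mp_eval_mult_carrier)
  then have r': "- r \<in> carrier_vec N"
    by simp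
  have "(\<Sum>i<N. u $ i * (- r) $ i) = - (\<Sum>i<N. u $ i * r $ i)"
    unfolding sum_negf[symmetric] using r by (intro sum.cong) auto
  then have c: "cmod (\<Sum>i<N. u $ i * (- r) $ i) = cmod (\<Sum>i<N. u $ i * r $ i)"
    by (simp only: norm_minus_cancel)
  obtain A where A: "A \<in> carrier_mat N N" "transpose_mat A = A" "A *\<^sub>v u = - r"
    and eq: "norm_mat Frobenius A = sqrt (2 * (norm2_vec r)\<^sup>2
       - (cmod (\<Sum>i<N. u $ i * r $ i))\<^sup>2 / (norm2_vec u)\<^sup>2) / norm2_vec u"
    and least: "\<And>B. B \<in> carrier_mat N N \<Longrightarrow> transpose_mat B = B \<Longrightarrow> B *\<^sub>v u = - r
       \<Longrightarrow> norm_mat Frobenius A \<le> norm_mat Frobenius B"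
    using symmetric_min_Frobenius[OF u r', unfolded c norm2_vec_uminus] by blast
  have "structured_backward_error Frobenius (sym_mat_polys k N) k lam u Q
      = norm_mat Frobenius A / power_norm k lam"
  proof (rule structured_backward_error_eqI[OF Q u(1) A(1) _ sym_mat_polys_subset
        spread_mat_in_sym_mat_polys[OF A(1,2)]])
    fix \<Delta> assume \<Delta>: "\<Delta> \<in> sym_mat_polys k N" "mp_eval \<Delta> lam *\<^sub>v u = - (mp_eval Q lam *\<^sub>v u)"
    have "mp_eval \<Delta> lam \<in> carrier_mat N N"
      by (rule mp_eval_carrier[OF subsetD[OF sym_mat_polys_subset \<Delta>(1)]])
    then show "norm_mat Frobenius A \<le> norm_mat Frobenius (mp_eval \<Delta> lam)"
      using \<Delta>(2) by (intro least transpose_mp_eval[OF \<Delta>(1)]) (simp_all only: r_def)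
  qed (simp only: A(3) r_def)
  then show ?thesis
    by (simp only: eq)
qed

subsection \<open>Kronecker products\<close>

text \<open>An index below \<open>m * n\<close> is position \<open>i mod n\<close> in block
  \<open>i div n\<close>, so the sum can be grouped into blocks of length \<open>n\<close>. Sums
  over Kronecker products become double sums in this way.\<close>

lemma sum_div_mod: "(\<Sum>i<m * n. f (i div n) (i mod n)) = (\<Sum>a<m. \<Sum>b<n. f a b)"
  for f :: "nat \<Rightarrow> nat \<Rightarrow> 'a :: comm_monoid_add"
proof -
  have "(\<Sum>i<m * n. f (i div n) (i mod n)) = (\<Sum>a<m. \<Sum>i\<in>{a * n..<a * n + n}. f (i div n) (i mod n))"
    by (rule sum.nat_group[symmetric])
  also have "\<dots> = (\<Sum>a<m. \<Sum>b<n. f a b)"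
  proof (rule sum.cong[OF refl])
    fix a
    have "(\<Sum>i\<in>{0 + a * n..<n + a * n}. f (i div n) (i mod n))
        = (\<Sum>b\<in>{0..<n}. f ((b + a * n) div n) ((b + a * n) mod n))"
      by (rule sum.shift_bounds_nat_ivl)
    also have "\<dots> = (\<Sum>b<n. f a b)"
      by (intro sum.cong) auto
    finally show "(\<Sum>i\<in>{a * n..<a * n + n}. f (i div n) (i mod n)) = (\<Sum>b<n. f a b)"
      by (simp add: add.commute)
  qed
  finally show ?thesis .
qed

lemma kron_vec_carrier: "v \<in> carrier_vec m \<Longrightarrow> x \<in> carrier_vec n \<Longrightarrow> kron_vec v x \<in> carrier_vec (m * n)"
  by (auto simp: kron_vec_def)

lemma kron_vec_dot:
  fixes v w x y :: "complex vec"
  assumes "v \<in> carrier_vec m" "w \<in> carrier_vec m" "x \<in> carrier_vec n" "y \<in> carrier_vec n"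
  shows "(\<Sum>i<m * n. kron_vec v x $ i * kron_vec w y $ i)
    = (\<Sum>a<m. v $ a * w $ a) * (\<Sum>b<n. x $ b * y $ b)"
proof -
  have "(\<Sum>i<m * n. kron_vec v x $ i * kron_vec w y $ i)
      = (\<Sum>i<m * n. (v $ (i div n) * w $ (i div n)) * (x $ (i mod n) * y $ (i mod n)))"
    using assms by (intro sum.cong) (auto simp: kron_vec_def)
  then show ?thesis
    by (simp add: sum_div_mod[of "\<lambda>a b. (v $ a * w $ a) * (x $ b * y $ b)"] sum_product)
qed

lemma norm2_kron_vec: "norm2_vec (kron_vec v x) = norm2_vec v * norm2_vec x"
proof -
  have "norm2_vec (kron_vec v x) = sqrt (\<Sum>i<dim_vec v * dim_vec x.
      (cmod (v $ (i div dim_vec x)))\<^sup>2 * (cmod (x $ (i mod dim_vec x)))\<^sup>2)"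
    by (auto simp: norm2_vec_def L2_set_def kron_vec_def norm_mult power_mult_distrib)
  then show ?thesis
    by (simp add: sum_div_mod[of "\<lambda>a b. (cmod (v $ a))\<^sup>2 * (cmod (x $ b))\<^sup>2"] sum_product[symmetric]
        real_sqrt_mult norm2_vec_def L2_set_def)
qed

text \<open>An instance of the mixed-product rule, with \<open>x\<close> read as the Kronecker
  product of the scalar 1 with \<open>x\<close>.\<close>

lemma kron_mat_col_mult:
  fixes w x :: "complex vec"
  assumes w: "w \<in> carrier_vec m" and B: "B \<in> carrier_mat n n" and x: "x \<in> carrier_vec n"
  shows "kron_mat (col_mat w) B *\<^sub>v x = kron_vec w (B *\<^sub>v x)"
proof (rule eq_vecI)
  fix i assume "i < dim_vec (kron_vec w (B *\<^sub>v x))"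
  then have i: "i < m * n"
    using w B by (simp add: kron_vec_def)
  \<comment> \<open>The existence of an index \<open>i\<close> excludes \<open>n = 0\<close>, where
    \<open>div\<close> and \<open>mod\<close> would not give block coordinates.\<close>
  then have n: "n > 0" "i div n < m"
    by (auto simp: less_mult_imp_div_less intro: Nat.gr0I)
  have K: "kron_mat (col_mat w) B \<in> carrier_mat (m * n) n"
    using w B by (simp add: kron_mat_def col_mat_def)
  have "(kron_mat (col_mat w) B *\<^sub>v x) $ i = (\<Sum>j<n. w $ (i div n) * (B $$ (i mod n, j) * x $ j))"
    unfolding mult_mat_vec_nth[OF K x i]
    using w B i n by (intro sum.cong refl) (simp add: kron_mat_def col_mat_def mat_of_cols_def mult.assoc)
  also have "\<dots> = kron_vec w (B *\<^sub>v x) $ i"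
    using i n w B by (simp add: kron_vec_def mult_mat_vec_nth[OF B x] sum_distrib_left[symmetric]
        del: index_mult_mat_vec)
  finally show "(kron_mat (col_mat w) B *\<^sub>v x) $ i = kron_vec w (B *\<^sub>v x) $ i" .
qed (use w B in \<open>simp add: kron_mat_def kron_vec_def col_mat_def\<close>)

text \<open>The ansatz identity at \<open>z = lam\<close>, applied to \<open>x\<close>. It expresses
  the residual of the pencil through that of the polynomial.\<close>

lemma L1_eval_kron:
  assumes L: "L \<in> carrier_mat (m * n) (m * n)" and P: "P \<in> carrier_mat n n"
    and v: "right_ansatz_vec m n P L v" and x: "x \<in> carrier_vec n"
  shows "mp_eval L lam *\<^sub>v kron_vec (Lambda_vec m lam) x = kron_vec v (mp_eval P lam *\<^sub>v x)"
proof -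
  have \<Lambda>: "Lambda_vec m lam \<in> carrier_vec m"
    by (simp add: Lambda_vec_def)
  have "mp_eval L lam *\<^sub>v kron_vec (Lambda_vec m lam) x
      = mp_eval L lam *\<^sub>v (kron_mat (col_mat (Lambda_vec m lam)) (1\<^sub>m n) *\<^sub>v x)"
    using kron_mat_col_mult[OF \<Lambda> one_carrier_mat x] x by simp
  also have "\<dots> = (mp_eval L lam * kron_mat (col_mat (Lambda_vec m lam)) (1\<^sub>m n)) *\<^sub>v x"
    using L x by (intro assoc_mult_mat_vec[symmetric])
      (auto simp: mp_eval_def kron_mat_def col_mat_def Lambda_vec_def)
  also have "\<dots> = kron_mat (col_mat v) (mp_eval P lam) *\<^sub>v x"
    using v by (simp add: right_ansatz_vec_def)
  also have "\<dots> = kron_vec v (mp_eval P lam *\<^sub>v x)"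
    using v P x by (intro kron_mat_col_mult) (auto simp: right_ansatz_vec_def mp_eval_def)
  finally show ?thesis .
qed

text \<open>The entries of \<open>Lambda_vec\<close> are the powers in descending order, and its
  first argument is the length, one more than the top exponent; reversing the order does not change
  the norm.\<close>

lemma norm2_Lambda_vec: "norm2_vec (Lambda_vec (Suc k) lam) = power_norm k lam"
proof -
  have "(\<Sum>i<Suc k. (cmod (lam ^ (k - i)))\<^sup>2) = (\<Sum>i<Suc k. (cmod (lam ^ i))\<^sup>2)"
    using sum.nat_diff_reindex[of "\<lambda>i. (cmod (lam ^ i))\<^sup>2" "Suc k"] by simp
  then show ?thesis
    by (simp add: norm2_vec_def power_norm_def L2_set_def Lambda_vec_def lessThan_Suc_atMost
        del: sum.lessThan_Suc)
qed

section \<open>Geometric sums and the ratio of power norms\<close>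

text \<open>The factors \<open>1 - t ^ i\<close> and \<open>1 - t ^ j\<close> never have opposite
  signs; expanding their nonnegative product gives the claim.\<close>

lemma add_le_one_plus_mult_power: "t ^ i + t ^ j \<le> 1 + t ^ (i + j)" if "t \<ge> 0" for t :: real
proof -
  have "0 \<le> (1 - t ^ i) * (1 - t ^ j)"
  proof (cases "t \<le> 1")
    case True
    with that show ?thesis
      by (simp add: power_le_one)
  next
    case False
    then show ?thesis
      by (intro mult_nonpos_nonpos) auto
  qed
  then show ?thesis
    by (simp add: algebra_simps power_add)
qed

lemma geometric_product_bounds:
  fixes t :: real
  assumes t: "t \<ge> 0"
  defines "S \<equiv> \<lambda>k. \<Sum>j\<le>k. t ^ j"
  shows "S (Suc p) \<le> S p * (1 + t)"
    and "real (p + 2) * (S p * (1 + t)) \<le> real (2 * (p + 1)) * S (Suc p)"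
proof -
  \<comment> \<open>With U = t + ... + t^p, the two sides are S p * (1 + t) = 1 + 2 U + t^(p+1) and
    S (p+1) = 1 + U + t^(p+1). The claims thus reduce to 0 <= U and 2 U <= p (1 + t^(p+1)).\<close>
  define U where "U = (\<Sum>j<p. t ^ Suc j)"
  have U: "U \<ge> 0"
    using t by (simp add: U_def sum_nonneg)
  have Sp: "S p = 1 + U"
    unfolding S_def U_def lessThan_Suc_atMost[symmetric] sum.lessThan_Suc_shift by simp
  have tS: "t * S p = U + t ^ Suc p"
    unfolding S_def U_def lessThan_Suc_atMost[symmetric] sum_distrib_left by simp
  have SS: "S (Suc p) = 1 + U + t ^ Suc p"
    using Sp by (simp add: S_def)
  \<comment> \<open>The sum is added to its own reversal, so that the exponents \<open>Suc j\<close>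
    and \<open>p - j\<close> of each pair add up to \<open>Suc p\<close>.\<close>
  have "2 * U = (\<Sum>j<p. t ^ Suc j) + (\<Sum>j<p. t ^ Suc (p - Suc j))"
    unfolding sum.nat_diff_reindex[of "\<lambda>j. t ^ Suc j"] by (simp add: U_def)
  also have "\<dots> = (\<Sum>j<p. t ^ Suc j + t ^ (p - j))"
    unfolding sum.distrib[symmetric] by (intro sum.cong refl) (auto simp: Suc_diff_Suc simp del: power_Suc)
  also have "\<dots> \<le> (\<Sum>j<p. 1 + t ^ Suc p)"
  proof (rule sum_mono)
    fix j assume "j \<in> {..<p}"
    then have "Suc j + (p - j) = Suc p" by simp
    with add_le_one_plus_mult_power[OF t, of "Suc j" "p - j"]
    show "t ^ Suc j + t ^ (p - j) \<le> 1 + t ^ Suc p" by (simp only:)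
  qed
  finally have 2: "2 * U \<le> real p * (1 + t ^ Suc p)" by simp
  have prod: "S p * (1 + t) = 1 + 2 * U + t ^ Suc p"
    using Sp tS by (simp add: algebra_simps)
  show "S (Suc p) \<le> S p * (1 + t)"
    unfolding prod SS using U by simp
  show "real (p + 2) * (S p * (1 + t)) \<le> real (2 * (p + 1)) * S (Suc p)"
    unfolding prod SS using 2 by (simp add: algebra_simps)
qed

text \<open>Squaring turns \<rho> into a quotient of geometric sums in t = |lam|^2, to which
  \<open>geometric_product_bounds\<close> applies with p = m - 1.\<close>

lemma power_norm_ratio_bounds:
  fixes lam :: complex
  assumes "m \<ge> 1"
  defines "\<rho> \<equiv> power_norm m lam / (power_norm (m - 1) lam * power_norm 1 lam)"
  shows "sqrt (real (m + 1) / real (2 * m)) \<le> \<rho>" "\<rho> \<le> 1"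
proof -
  obtain p where m: "m = Suc p"
    using assms by (cases m) auto
  define t where "t = (cmod lam)\<^sup>2"
  have t: "t \<ge> 0" by (simp add: t_def)
  have pos: "0 < power_norm p lam * power_norm 1 lam"
    by (simp add: power_norm_pos)
  have sq: "(power_norm p lam * power_norm 1 lam)\<^sup>2 = (\<Sum>j\<le>p. t ^ j) * (1 + t)"
    unfolding power_mult_distrib power_norm_sq t_def by simp
  have sq': "(power_norm m lam)\<^sup>2 = (\<Sum>j\<le>Suc p. t ^ j)"
    unfolding power_norm_sq t_def m ..
  have "power_norm m lam \<le> power_norm p lam * power_norm 1 lam"
    by (rule power2_le_imp_le[OF _ less_imp_le[OF pos]])
      (unfold sq sq', rule geometric_product_bounds(1)[OF t])
  then show "\<rho> \<le> 1"
    using pos by (simp add: \<rho>_def m)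
  have "0 < (\<Sum>j\<le>p. t ^ j) * (1 + t)"
    unfolding sq[symmetric] by (rule zero_less_power[OF pos])
  then have "real (m + 1) / real (2 * m) \<le> \<rho>\<^sup>2"
    using geometric_product_bounds(2)[OF t, of p]
    unfolding \<rho>_def m diff_Suc_1 power_divide sq sq'[unfolded m]
    by (simp add: divide_simps mult_ac del: sum.atMost_Suc)
  then show "sqrt (real (m + 1) / real (2 * m)) \<le> \<rho>"
    using power_norm_pos pos by (intro real_le_lsqrt) (auto simp: \<rho>_def less_imp_le m)
qed

section \<open>Comparison of the backward errors of the pencil and of the polynomial\<close>

theorem theorem4p3:
  fixes m n :: nat and P L :: "complex poly mat" and v x :: "complex vec"
    and lam :: complex and M M' :: matrix_norm
  assumes "m \<ge> 1" and "n \<ge> 1"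
    and "P \<in> sym_mat_polys m n" and "regular_mp P"
    and "L \<in> L1_space m n P" and "L \<in> sym_mat_polys 1 (m * n)"
    and "linearization_of m n P L"
    and "right_ansatz_vec m n P L v" and "norm2_vec v = 1"
    and "x \<in> carrier_vec n" and "norm2_vec x = 1"
    and "mp_eval P lam *\<^sub>v x \<noteq> 0\<^sub>v n"
  shows
    "sqrt (real (m + 1) / real (2 * m))
       \<le> structured_backward_error Frobenius (sym_mat_polys 1 (m * n)) 1 lam
            (kron_vec (Lambda_vec m lam) x) L
         / structured_backward_error Frobenius (sym_mat_polys m n) m lam x P
     \<and> structured_backward_error Frobenius (sym_mat_polys 1 (m * n)) 1 lam
            (kron_vec (Lambda_vec m lam) x) L
         / structured_backward_error Frobenius (sym_mat_polys m n) m lam x P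
       \<le> structured_backward_error Frobenius (sym_mat_polys 1 (m * n)) 1 lam
            (kron_vec (Lambda_vec m lam) x) L
         / backward_error M m lam x P
     \<and> structured_backward_error Frobenius (sym_mat_polys 1 (m * n)) 1 lam
            (kron_vec (Lambda_vec m lam) x) L
         / backward_error M m lam x P
       \<le> sqrt 2
     \<and> sqrt (real (m + 1) / real (2 * m))
       \<le> structured_backward_error Spectral (sym_mat_polys 1 (m * n)) 1 lam
            (kron_vec (Lambda_vec m lam) x) L
         / structured_backward_error Spectral (sym_mat_polys m n) m lam x P
     \<and> structured_backward_error Spectral (sym_mat_polys 1 (m * n)) 1 lam
            (kron_vec (Lambda_vec m lam) x) L
         / structured_backward_error Spectral (sym_mat_polys m n) m lam x P
       = backward_error M' 1 lam (kron_vec (Lambda_vec m lam) x) L / backward_error M m lam x P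
     \<and> backward_error M' 1 lam (kron_vec (Lambda_vec m lam) x) L / backward_error M m lam x P \<le> 1"
proof -
  have P: "P \<in> carrier_mat n n" and L: "L \<in> carrier_mat (m * n) (m * n)"
    using assms(3,6) by (auto simp: sym_mat_polys_def mat_polys_def)
  note x = assms(10)
  define \<Lambda> where "\<Lambda> = Lambda_vec m lam"
  define u where "u = kron_vec \<Lambda> x"
  define r where "r = mp_eval P lam *\<^sub>v x"
  define a where "a = power_norm (m - 1) lam"
  define b where "b = power_norm 1 lam"
  define d where "d = power_norm m lam"
  define R where "R = norm2_vec r"
  define g where "g = cmod (\<Sum>i<n. x $ i * r $ i)"
  define G where "G = cmod (\<Sum>i<m * n. u $ i * kron_vec v r $ i)"
  have v: "v \<in> carrier_vec m"
    using assms(8) by (simp add: right_ansatz_vec_def)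
  have \<Lambda>: "\<Lambda> \<in> carrier_vec m"
    by (simp add: \<Lambda>_def Lambda_vec_def)
  have r: "r \<in> carrier_vec n"
    unfolding r_def by (rule mp_eval_mult_carrier[OF P x])
  have x0: "x \<noteq> 0\<^sub>v n"
    using assms(11) by auto
  have norm\<Lambda>: "norm2_vec \<Lambda> = a"
    using assms(1) norm2_Lambda_vec[of "m - 1" lam] by (simp add: \<Lambda>_def a_def)
  have pos: "a > 0" "b > 0" "d > 0"
    by (simp_all add: a_def b_def d_def power_norm_pos)
  have norm_u: "norm2_vec u = a"
    by (simp add: u_def norm2_kron_vec norm\<Lambda> assms(11))
  have u: "u \<in> carrier_vec (m * n)"
    unfolding u_def by (rule kron_vec_carrier[OF \<Lambda> x])
  have u0: "u \<noteq> 0\<^sub>v (m * n)"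
    using norm_u pos by auto
  have Lu: "mp_eval L lam *\<^sub>v u = kron_vec v r"
    unfolding u_def \<Lambda>_def r_def by (rule L1_eval_kron[OF L P assms(8) x])
  have norm_vr: "norm2_vec (kron_vec v r) = R"
    by (simp add: norm2_kron_vec assms(9) R_def)
  have R: "R > 0"
    unfolding R_def using r assms(12) by (intro norm2_vec_pos) (auto simp: r_def)
  have dot_le: "cmod (\<Sum>i<N. y $ i * z $ i) \<le> norm2_vec y * norm2_vec z"
    if "y \<in> carrier_vec N" "z \<in> carrier_vec N" for y z N
    using norm_sum_mult_le[of "\<lambda>i. y $ i" "\<lambda>i. z $ i" "{..<N}"] that by (simp add: norm2_vec_def)
  have g: "g \<le> R" "0 \<le> g"
    using dot_le[OF x r] by (simp_all add: g_def R_def assms(11))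
  \<comment> \<open>The bilinear product of two Kronecker products factors, and the first factor is
    at most \<open>a\<close> because \<open>v\<close> has norm 1.\<close>
  have "G = cmod (\<Sum>i<m. \<Lambda> $ i * v $ i) * g"
    unfolding G_def u_def g_def kron_vec_dot[OF \<Lambda> v x r] norm_mult ..
  also have "\<dots> \<le> a * g"
    using dot_le[OF \<Lambda> v] g by (intro mult_right_mono) (simp_all add: norm\<Lambda> assms(9))
  finally have "G\<^sup>2 \<le> (a * g)\<^sup>2"
    by (intro power_mono) (simp_all add: G_def)
  then have G: "G\<^sup>2 / a\<^sup>2 \<le> g\<^sup>2"
    using pos by (simp add: power_mult_distrib divide_le_eq mult.commute)
  have gR: "g\<^sup>2 \<le> R\<^sup>2"
    using g by (intro power_mono)
  have backP: "backward_error N m lam x P = R / d" for N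
    using backward_error_eq[OF P x x0] by (simp add: r_def R_def d_def assms(11))
  have backL: "backward_error N 1 lam u L = R / a / b" for N
    using backward_error_eq[OF L u u0] by (simp add: Lu norm_vr norm_u b_def)
  have specP: "structured_backward_error Spectral (sym_mat_polys m n) m lam x P = R / d"
    using symmetric_backward_error_Spectral[OF P x x0] by (simp add: r_def R_def d_def assms(11))
  have specL: "structured_backward_error Spectral (sym_mat_polys 1 (m * n)) 1 lam u L = R / a / b"
    using symmetric_backward_error_Spectral[OF L u u0] by (simp add: Lu norm_vr norm_u b_def)
  define f where "f = sqrt (2 * R\<^sup>2 - g\<^sup>2)"
  define F where "F = sqrt (2 * R\<^sup>2 - G\<^sup>2 / a\<^sup>2)"
  have frobP: "structured_backward_error Frobenius (sym_mat_polys m n) m lam x P = f / d"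
    using symmetric_backward_error_Frobenius[OF P x x0 r_def]
    by (simp add: f_def R_def g_def d_def assms(11))
  have frobL: "structured_backward_error Frobenius (sym_mat_polys 1 (m * n)) 1 lam u L = F / a / b"
    using symmetric_backward_error_Frobenius[OF L u u0 Lu[symmetric]]
    by (simp add: F_def G_def b_def norm_vr norm_u)
  \<comment> \<open>As \<open>g \<le> R\<close>, the radicand is at least R^2. In particular
    \<open>f\<close> is positive and may be divided by.\<close>
  have Rf: "R \<le> f"
    unfolding f_def using gR by (intro real_le_rsqrt) simp
  have fF: "f \<le> F"
    unfolding f_def F_def using G by simp
  have FR: "F \<le> sqrt 2 * R"
  proof -
    have "F \<le> sqrt (2 * R\<^sup>2)"
      by (simp add: F_def)
    then show ?thesis
      using R by (simp add: real_sqrt_mult)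
  qed
  have \<rho>: "sqrt (real (m + 1) / real (2 * m)) \<le> d / (a * b)" "d / (a * b) \<le> 1"
    unfolding a_def b_def d_def by (fact power_norm_ratio_bounds[OF assms(1)])+
  \<comment> \<open>Each quotient is \<open>d / (a * b)\<close> times \<open>F / f\<close>,
    \<open>F / R\<close> or 1. The chain \<open>R \<le> f \<le> F \<le> sqrt 2 * R\<close> and the
    bounds \<rho> then give all the estimates.\<close>
  have 1: "(F / a / b) / (f / d) = d / (a * b) * (F / f)"
    by simp
  have 2: "(F / a / b) / (R / d) = d / (a * b) * (F / R)"
    by simp
  have 3: "(R / a / b) / (R / d) = d / (a * b)"
    using R by simp
  have "d / (a * b) * 1 \<le> d / (a * b) * (F / f)"
    using pos R Rf fF by (intro mult_left_mono) auto
  moreover have "d / (a * b) * (F / f) \<le> d / (a * b) * (F / R)"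
    using pos R Rf fF by (intro mult_left_mono divide_left_mono) auto
  moreover have "d / (a * b) * (F / R) \<le> 1 * sqrt 2"
    using pos R Rf fF FR \<rho> by (intro mult_mono) (auto simp: divide_le_eq)
  ultimately show ?thesis
    unfolding \<Lambda>_def[symmetric] u_def[symmetric] frobL frobP specL specP backL backP 1 2 3
    using \<rho> by auto
qed

end
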